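(* Let $A\in\mathbb{R}^{n\times n}$, $B\in\mathbb{R}^{n\times m}$ with $(A,B)$ controllable, and let $u_d(0),\dots,u_d(T-1)\in\mathbb{R}^m$ and $x_d(0),\dots,x_d(T)\in\mathbb{R}^n$ be data satisfying $x_d(k+1)=Ax_d(k)+Bu_d(k)$ for $k=0,\dots,T-1$. Let $U_{0,1,T}$, $X_{0,T}$, $X_{1,T}$ be the data matrices defined in the context, and suppose that $$\operatorname{rank}\begin{bmatrix}U_{0,1,T}\\ X_{0,T}\end{bmatrix}=n+m .$$ Then, for every $K\in\mathbb{R}^{m\times n}$, the system $x(k+1)=Ax(k)+Bu(k)$ in closed loop with the state feedback $u=Kx$ has the equivalent representation $$x(k+1)=X_{1,T}\,G_K\,x(k),$$ where $G_K$ is a $T\times n$ matrix satisfying $$\begin{bmatrix}K\\ I_n\end{bmatrix}=\begin{bmatrix}U_{0,1,T}\\ X_{0,T}\end{bmatrix}G_K .$$ That is, at least one such $G_K$ exists, and every such $G_K$ satisfies $A+BK=X_{1,T}G_K$. In particular, $u(k)=U_{0,1,T}\,G_K\,x(k)$.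
   Context: Data matrices: $U_{0,1,T}=[u_d(0)\ u_d(1)\ \cdots\ u_d(T-1)]\in\mathbb{R}^{m\times T}$, $X_{0,T}=[x_d(0)\ x_d(1)\ \cdots\ x_d(T-1)]\in\mathbb{R}^{n\times T}$, $X_{1,T}=[x_d(1)\ x_d(2)\ \cdots\ x_d(T)]\in\mathbb{R}^{n\times T}$. *)

theory Defs
  imports "Jordan_Normal_Form.DL_Rank"
begin

text \<open>
  In discrete time, controllability is sometimes understood as steering to the origin only;
  here the target state is arbitrary.
\<close>

definition controllable :: "real mat \<Rightarrow> real mat \<Rightarrow> bool" where
  "controllable A B \<longleftrightarrow>
     (\<forall>x0 \<in> carrier_vec (dim_row A). \<forall>x1 \<in> carrier_vec (dim_row A).
       \<exists>(N :: nat) (u :: nat \<Rightarrow> real vec) (x :: nat \<Rightarrow> real vec).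
         (\<forall>k<N. u k \<in> carrier_vec (dim_col B)) \<and>
         x 0 = x0 \<and>
         (\<forall>k<N. x (Suc k) = A *\<^sub>v x k + B *\<^sub>v u k) \<and>
         x N = x1)"

definition data_matrix :: "nat \<Rightarrow> (nat \<Rightarrow> real vec) \<Rightarrow> nat \<Rightarrow> nat \<Rightarrow> real mat" where
  "data_matrix d z i N = mat_of_cols d (map z [i..<i + N])"

definition closed_loop_trajectory ::
  "real mat \<Rightarrow> real mat \<Rightarrow> real mat \<Rightarrow> (nat \<Rightarrow> real vec) \<Rightarrow> (nat \<Rightarrow> real vec) \<Rightarrow> bool" where
  "closed_loop_trajectory A B K x u \<longleftrightarrow>
     (\<forall>k. x (Suc k) = A *\<^sub>v x k + B *\<^sub>v u k) \<and> (\<forall>k. u k = K *\<^sub>v x k)"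

end

theory Submission
  imports Defs
begin

text \<open>Stacked as columns, the data recursion reads \<open>X1 = A * X0 + B * U0\<close>
  (\<open>data_matrix_step\<close>). The rank condition says that the stacked data matrix has full
  row rank, so its columns span the whole space and every right-hand side, in particular
  \<open>K\<close> stacked on the identity, is reached by some \<open>G\<close>
  (\<open>full_row_rank_imp_mat_solvable\<close>). For any such \<open>G\<close>, comparing blocks
  gives \<open>U0 * G = K\<close> and \<open>X0 * G = 1\<close>, so multiplying the recursion by
  \<open>G\<close> on the right yields \<open>X1 * G = A + B * K\<close>. The unknown pair A, B thus
  enters the closed loop only through the data.\<close>

text \<open>A maximal independent set of columns has as many elements as the rank. Here that is the
  dimension of the space, so the set is a basis and the column space is everything.\<close>

lemma (in vec_space) full_row_rank_imp_solvable:
  assumes M: "M \<in> carrier_mat n nc" and full: "rank M = n" and b: "b \<in> carrier_vec n"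
  obtains g where "g \<in> carrier_vec nc" "M *\<^sub>v g = b"
proof -
  let ?C = "set (cols M)"
  have C: "?C \<subseteq> carrier_vec n"
    using cols_dim M by blast
  \<comment> \<open>The empty set is independent, and the finite set of columns bounds how far it
    can be enlarged.\<close>
  obtain S where S: "maximal S (\<lambda>T. T \<subseteq> ?C \<and> lin_indpt T)"
    using maximal_exists_superset[of ?C "\<lambda>T. T \<subseteq> ?C \<and> lin_indpt T" "{}"]
    by (auto simp: lin_dep_def)
  then have "S \<subseteq> ?C" "lin_indpt S"
    by (auto simp: maximal_def)
  moreover have "card S = n"
    using rank_card_indpt[OF M S] full by simp
  ultimately have "basis S"
    using C by (intro dim_li_is_basis) (auto simp: dim_is_n intro: finite_subset)
  then have "b \<in> span S"
    using b by (simp add: basis_def)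
  then have "b \<in> col_space M"
    using span_is_monotone[OF \<open>S \<subseteq> ?C\<close>] by (auto simp: col_space_def)
  then show thesis
    using col_space_eq[OF M] M that by auto
qed

text \<open>A matrix equation is one linear system per column of the right-hand side; the chosen
  solutions become the columns of \<open>G\<close>.\<close>

lemma (in vec_space) full_row_rank_imp_mat_solvable:
  assumes M: "M \<in> carrier_mat n nc" and full: "rank M = n" and Y: "Y \<in> carrier_mat n k"
  obtains G where "G \<in> carrier_mat nc k" "M * G = Y"
proof -
  have "\<exists>g. g \<in> carrier_vec nc \<and> M *\<^sub>v g = col Y j" if "j < k" for j
    using full_row_rank_imp_solvable[OF M full, of "col Y j"] Y that by auto
  then obtain g where g: "\<And>j. j < k \<Longrightarrow> g j \<in> carrier_vec nc \<and> M *\<^sub>v g j = col Y j"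
    by metis
  let ?G = "mat_of_cols nc (map g [0..<k])"
  have G: "?G \<in> carrier_mat nc k"
    using mat_of_cols_carrier(1)[of nc "map g [0..<k]"] by simp
  have "M * ?G = Y"
  proof (rule mat_col_eqI)
    fix j assume "j < dim_col Y"
    then have "j < k"
      using Y by simp
    then have "col ?G j = g j"
      using g by (subst col_mat_of_cols) auto
    then show "col (M * ?G) j = col Y j"
      using col_mult2[OF M G \<open>j < k\<close>] g[OF \<open>j < k\<close>] by simp
  qed (use M Y G in auto)
  then show thesis
    using G that by blast
qed

lemma append_rows_mult:
  fixes P Q G :: "'a :: semiring_0 mat"
  assumes "P \<in> carrier_mat r1 c" "Q \<in> carrier_mat r2 c" "G \<in> carrier_mat c d"
  shows "(P @\<^sub>r Q) * G = P * G @\<^sub>r Q * G"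
  using assms
  by (intro eq_matI) (auto simp: append_rows_def row_four_block_mat(1,2) scalar_prod_def)

text \<open>Lets a stacked equation be split into its two blocks: entries of the lower block are
  read off at rows shifted by \<open>r1\<close>.\<close>

lemma append_rows_inject:
  assumes "P \<in> carrier_mat r1 c" "P' \<in> carrier_mat r1 c"
    and "Q \<in> carrier_mat r2 c" "Q' \<in> carrier_mat r2 c"
  shows "P @\<^sub>r Q = P' @\<^sub>r Q' \<longleftrightarrow> P = P' \<and> Q = Q'"
proof
  assume eq: "P @\<^sub>r Q = P' @\<^sub>r Q'"
  have "P $$ (i, j) = P' $$ (i, j)" if "i < r1" "j < c" for i j
    using arg_cong[OF eq, of "\<lambda>M. M $$ (i, j)"] assms that by (simp add: append_rows_def)
  moreover have "Q $$ (i, j) = Q' $$ (i, j)" if "i < r2" "j < c" for i j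
    using arg_cong[OF eq, of "\<lambda>M. M $$ (r1 + i, j)"] assms that by (simp add: append_rows_def)
  ultimately show "P = P' \<and> Q = Q'"
    using assms by (auto intro!: eq_matI)
qed simp

lemma data_matrix_carrier [simp]: "data_matrix d z i N \<in> carrier_mat d N"
  using mat_of_cols_carrier(1)[of d "map z [i..<i + N]"] by (simp add: data_matrix_def)

lemma dim_data_matrix [simp]:
  "dim_row (data_matrix d z i N) = d" "dim_col (data_matrix d z i N) = N"
  using data_matrix_carrier[of d z i N] by (auto simp del: data_matrix_carrier)

lemma col_data_matrix:
  assumes "k < N" "z (i + k) \<in> carrier_vec d"
  shows "col (data_matrix d z i N) k = z (i + k)"
  using assms by (simp add: data_matrix_def col_mat_of_cols)

lemma data_matrix_step:
  assumes A: "A \<in> carrier_mat n n" and B: "B \<in> carrier_mat n m"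
    and u: "\<forall>k<T. u k \<in> carrier_vec m" and x: "\<forall>k\<le>T. x k \<in> carrier_vec n"
    and step: "\<forall>k<T. x (Suc k) = A *\<^sub>v x k + B *\<^sub>v u k"
  shows "data_matrix n x 1 T = A * data_matrix n x 0 T + B * data_matrix m u 0 T"
    (is "?X1 = A * ?X0 + B * ?U0")
proof (rule mat_col_eqI)
  have AX: "A * ?X0 \<in> carrier_mat n T" and BU: "B * ?U0 \<in> carrier_mat n T"
    using A B by (meson data_matrix_carrier mult_carrier_mat)+
  then show "dim_row ?X1 = dim_row (A * ?X0 + B * ?U0)" "dim_col ?X1 = dim_col (A * ?X0 + B * ?U0)"
    using B by auto
  fix k assume "k < dim_col (A * ?X0 + B * ?U0)"
  then have k: "k < T"
    using BU by simp
  have "col (A * ?X0 + B * ?U0) k = col (A * ?X0) k + col (B * ?U0) k"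
    using k AX BU by auto
  also have "\<dots> = A *\<^sub>v x k + B *\<^sub>v u k"
    using k u x col_mult2[OF A data_matrix_carrier k] col_mult2[OF B data_matrix_carrier k]
    by (simp add: col_data_matrix)
  finally show "col ?X1 k = col (A * ?X0 + B * ?U0) k"
    \<comment> \<open>Since the window of \<open>?X1\<close> starts at 1, its column
      \<open>k\<close> is \<open>x (Suc k)\<close>; the last column uses the sample
      \<open>x T\<close>, which is why the states are needed up to \<open>T\<close>
      inclusive.\<close>
    using k x step[rule_format, OF k, symmetric] col_data_matrix[of k T x 1 n] by simp
qed

theorem theorem2:
  fixes n m T :: nat
    and A B K :: "real mat"
    and u\<^sub>d x\<^sub>d :: "nat \<Rightarrow> real vec"
  defines "U0 \<equiv> data_matrix m u\<^sub>d 0 T"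
    and "X0 \<equiv> data_matrix n x\<^sub>d 0 T"
    and "X1 \<equiv> data_matrix n x\<^sub>d 1 T"
  assumes A: "A \<in> carrier_mat n n"
    and B: "B \<in> carrier_mat n m"
    and ctrb: "controllable A B"
    and u\<^sub>d: "\<forall>k<T. u\<^sub>d k \<in> carrier_vec m"
    and x\<^sub>d: "\<forall>k\<le>T. x\<^sub>d k \<in> carrier_vec n"
    and data: "\<forall>k<T. x\<^sub>d (Suc k) = A *\<^sub>v x\<^sub>d k + B *\<^sub>v u\<^sub>d k"
    and rank: "vec_space.rank (m + n) (U0 @\<^sub>r X0) = n + m"
    and K: "K \<in> carrier_mat m n"
  shows "(\<exists>G \<in> carrier_mat T n. K @\<^sub>r 1\<^sub>m n = (U0 @\<^sub>r X0) * G) \<and>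
    (\<forall>G \<in> carrier_mat T n. K @\<^sub>r 1\<^sub>m n = (U0 @\<^sub>r X0) * G \<longrightarrow>
      A + B * K = X1 * G \<and>
      (\<forall>x. (\<forall>k. x k \<in> carrier_vec n) \<longrightarrow>
        ((\<exists>u. closed_loop_trajectory A B K x u) \<longleftrightarrow>
         (\<forall>k. x (Suc k) = (X1 * G) *\<^sub>v x k))) \<and>
      (\<forall>x u. (\<forall>k. x k \<in> carrier_vec n) \<longrightarrow> closed_loop_trajectory A B K x u \<longrightarrow>
        (\<forall>k. u k = (U0 * G) *\<^sub>v x k)))"
proof -
  have U0: "U0 \<in> carrier_mat m T" and X0: "X0 \<in> carrier_mat n T"
    unfolding U0_def X0_def by simp_all
  have ex: "\<exists>G \<in> carrier_mat T n. K @\<^sub>r 1\<^sub>m n = (U0 @\<^sub>r X0) * G"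
  proof (rule vec_space.full_row_rank_imp_mat_solvable)
    show "U0 @\<^sub>r X0 \<in> carrier_mat (m + n) T" "K @\<^sub>r 1\<^sub>m n \<in> carrier_mat (m + n) n"
      using U0 X0 K by auto
    show "vec_space.rank (m + n) (U0 @\<^sub>r X0) = m + n"
      using rank by simp
  qed metis
  have rep: "A + B * K = X1 * G" and KG: "K = U0 * G"
    if G: "G \<in> carrier_mat T n" and eq: "K @\<^sub>r 1\<^sub>m n = (U0 @\<^sub>r X0) * G" for G
  proof -
    \<comment> \<open>The upper block says that \<open>G\<close> reproduces the gain, the lower one
      that it is a right inverse of \<open>X0\<close>.\<close>
    have KI: "K = U0 * G \<and> 1\<^sub>m n = X0 * G"
      using eq append_rows_mult[OF U0 X0 G] append_rows_inject[of K m n "U0 * G" "1\<^sub>m n" n "X0 * G"]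
        U0 X0 K G by auto
    then show "K = U0 * G"
      by simp
    have "X1 * G = A * X0 * G + B * U0 * G"
      using data_matrix_step[OF A B u\<^sub>d x\<^sub>d data] A B U0 X0 G
      unfolding U0_def X0_def X1_def by (metis add_mult_distrib_mat mult_carrier_mat)
    also have "\<dots> = A * (X0 * G) + B * (U0 * G)"
      using A B U0 X0 G by simp
    finally show "A + B * K = X1 * G"
      \<comment> \<open>The identity block turns \<open>A * (X0 * G)\<close> into \<open>A\<close>,
        and the gain block turns \<open>B * (U0 * G)\<close> into \<open>B * K\<close>.\<close>
      using A KI by (metis right_mult_one_mat)
  qed
  have closed_loop: "A *\<^sub>v v + B *\<^sub>v (K *\<^sub>v v) = (A + B * K) *\<^sub>v v" if "v \<in> carrier_vec n" for v
    using A B K that by (simp add: add_mult_distrib_mat_vec[of _ n n] assoc_mult_mat_vec[of _ n m _ n])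
  \<comment> \<open>The feedback law determines the input from the state, so the only possible
    witness is \<open>K\<close> applied to the state; eliminating it leaves an autonomous
    recursion.\<close>
  have "(\<exists>u. closed_loop_trajectory A B K x u) \<longleftrightarrow> (\<forall>k. x (Suc k) = (A + B * K) *\<^sub>v x k)"
    if "\<forall>k. x k \<in> carrier_vec n" for x
    using that closed_loop
    by (auto simp: closed_loop_trajectory_def intro!: exI[of _ "\<lambda>k. K *\<^sub>v x k"])
  \<comment> \<open>Replacing \<open>A + B * K\<close> by \<open>X1 * G\<close> gives the data-based
    recursion, and replacing \<open>K\<close> by \<open>U0 * G\<close> in the feedback law gives the
    input formula.\<close>
  then show ?thesis
    using ex rep KG by (simp add: closed_loop_trajectory_def)
qed

end
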